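(* Let $G$ be a connected graph (of order at least $2$). Then $\gamma_{tR}(G)=5$ if and only if $\gamma_t(G)=3$ and there exist a minimum dominating set $S$ of $G$ and a minimum total dominating set $T$ of $G$ such that $S\subset T$.
   Context: All graphs are finite and simple. A dominating set of $G$ is a set $S$ such that every vertex outside $S$ has a neighbour in $S$; $\gamma(G)$ is the minimum size of a dominating set (a minimum one is a $\gamma(G)$-set). A total dominating set of a graph with no isolated vertices is a set $T$ such that every vertex of $G$ has a neighbour in $T$; $\gamma_t(G)$ is its minimum size (a minimum one is a $\gamma_t(G)$-set). A total Roman dominating function (TRD-function) on $G$ is a function $f:V(G)\to\{0,1,2\}$ such that every vertex $v$ with $f(v)=0$ is adjacent to some vertex $u$ with $f(u)=2$, and the subgraph induced by $\{w: f(w)>0\}$ has no isolated vertices; its weight is $\sum_v f(v)$, and $\gamma_{tR}(G)$ is the minimum weight of a TRD-function on $G$. *)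

theory Defs
  imports "Graph_Theory.Digraph_Component"
begin

text \<open>
  A finite simple graph is rendered by the locale \<open>graph\<close>: a finite, loop-free,
  symmetric digraph without parallel arcs, each undirected edge being a pair of opposite arcs.
  Hence \<open>u \<rightarrow>\<^bsub>G\<^esub> v\<close> is the (symmetric) adjacency relation of \<open>G\<close>.
\<close>

definition no_isolated_verts :: "('a, 'b) pre_digraph \<Rightarrow> bool" where
  "no_isolated_verts G \<longleftrightarrow> (\<forall>v \<in> verts G. \<exists>u \<in> verts G. v \<rightarrow>\<^bsub>G\<^esub> u)"

definition dominating_set :: "('a, 'b) pre_digraph \<Rightarrow> 'a set \<Rightarrow> bool" where
  "dominating_set G S \<longleftrightarrow> S \<subseteq> verts G \<and> (\<forall>v \<in> verts G - S. \<exists>u \<in> S. v \<rightarrow>\<^bsub>G\<^esub> u)"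

definition domination_number :: "('a, 'b) pre_digraph \<Rightarrow> nat" where
  "domination_number G = (LEAST k. \<exists>S. dominating_set G S \<and> card S = k)"

definition min_dominating_set :: "('a, 'b) pre_digraph \<Rightarrow> 'a set \<Rightarrow> bool" where
  "min_dominating_set G S \<longleftrightarrow> dominating_set G S \<and> card S = domination_number G"

text \<open>
  A graph with an isolated vertex has no total dominating set and no total Roman dominating
  function; the values of the two minima below are meaningful only for graphs without isolated
  vertices.
\<close>

definition total_dominating_set :: "('a, 'b) pre_digraph \<Rightarrow> 'a set \<Rightarrow> bool" where
  "total_dominating_set G T \<longleftrightarrow> T \<subseteq> verts G \<and> (\<forall>v \<in> verts G. \<exists>u \<in> T. v \<rightarrow>\<^bsub>G\<^esub> u)"

definition total_domination_number :: "('a, 'b) pre_digraph \<Rightarrow> nat" where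
  "total_domination_number G = (LEAST k. \<exists>T. total_dominating_set G T \<and> card T = k)"

definition min_total_dominating_set :: "('a, 'b) pre_digraph \<Rightarrow> 'a set \<Rightarrow> bool" where
  "min_total_dominating_set G T \<longleftrightarrow>
     total_dominating_set G T \<and> card T = total_domination_number G"

text \<open>Only the values of \<open>f\<close> on the vertices of \<open>G\<close> matter.\<close>

definition trd_function :: "('a, 'b) pre_digraph \<Rightarrow> ('a \<Rightarrow> nat) \<Rightarrow> bool" where
  "trd_function G f \<longleftrightarrow>
     (\<forall>v \<in> verts G. f v \<in> {0, 1, 2}) \<and>
     (\<forall>v \<in> verts G. f v = 0 \<longrightarrow> (\<exists>u \<in> verts G. v \<rightarrow>\<^bsub>G\<^esub> u \<and> f u = 2)) \<and>
     no_isolated_verts (G \<restriction> {w \<in> verts G. f w > 0})"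

definition trd_weight :: "('a, 'b) pre_digraph \<Rightarrow> ('a \<Rightarrow> nat) \<Rightarrow> nat" where
  "trd_weight G f = (\<Sum>v \<in> verts G. f v)"

definition total_roman_domination_number :: "('a, 'b) pre_digraph \<Rightarrow> nat" where
  "total_roman_domination_number G = (LEAST k. \<exists>f. trd_function G f \<and> trd_weight G f = k)"

end

theory Submission
  imports Defs
begin

text \<open>
  The support of a TRD-function is a total dominating set, and conversely a total dominating set
  \<open>T\<close> containing a dominating set \<open>S\<close> carries a TRD-function of weight \<open>|T| + |S|\<close>, with value 2
  on \<open>S\<close> and 1 on \<open>T - S\<close>. Both directions rest on one observation: if some vertex \<open>u\<close> has at
  most one non-neighbour \<open>b\<close>, then \<open>u\<close> and a neighbour of \<open>b\<close> (of \<open>u\<close>, if there is no \<open>b\<close>) form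
  a total dominating set. So if \<open>\<gamma>\<^sub>t \<ge> 3\<close>, every vertex has at least two non-neighbours. This
  excludes TRD-functions of weight at most 4. In weight 5, two vertices of value 2 are a
  dominating set inside the support. Otherwise let \<open>u\<close> be the only vertex of value 2 or, if all of
  five vertices have value 1, a vertex of degree at least 2: it has exactly two non-neighbours
  \<open>b\<close>, \<open>c\<close>, and \<open>S\<close>, \<open>T\<close> are found according to whether \<open>b\<close> and \<open>c\<close> are adjacent.
\<close>

section \<open>Connected graphs of order at least 2: cut edges, neighbours, degrees\<close>

locale connected_graph = graph +
  assumes connected: "connected G"
    and order_ge_2: "card (verts G) \<ge> 2"
begin

lemma adj_sym: "u \<rightarrow> v \<Longrightarrow> v \<rightarrow> u"
  by (rule graph_symmetric)

text \<open>A walk from a vertex of \<open>X\<close> to a vertex outside must leave \<open>X\<close>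
  along some edge. The induction runs backwards from the outer end: if the current edge does not
  leave \<open>X\<close>, its head lies in \<open>X\<close> and the rest of the walk leaves
  it.\<close>

lemma cut_edge:
  assumes "X \<subset> verts G" "X \<noteq> {}"
  obtains x y where "x \<in> X" "y \<in> verts G - X" "x \<rightarrow> y"
proof -
  have sc: "strongly_connected G"
    using connected sym_arcs by (intro symmetric_connected_imp_strongly_connected) auto
  obtain a b where ab: "a \<in> X" "b \<in> verts G - X" using assms by blast
  have "a \<rightarrow>\<^sup>* b" using sc ab assms by (auto simp: strongly_connected_def)
  then have "\<exists>x y. x \<in> X \<and> y \<in> verts G - X \<and> x \<rightarrow> y" using ab(1)
  proof (induct rule: converse_reachable_induct)
    case base
    then show ?case using ab(2) by blast
  next
    case (step x y)
    then show ?case using adj_in_verts(2) by blast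
  qed
  then show thesis using that by blast
qed

lemma ex_neighbour:
  assumes "v \<in> verts G"
  obtains u where "u \<in> verts G" "v \<rightarrow> u" "u \<noteq> v"
proof -
  have "card {v} \<noteq> card (verts G)" using order_ge_2 by simp
  then have "verts G \<noteq> {v}" by metis
  then have "{v} \<subset> verts G" using assms by blast
  then show thesis using that by (elim cut_edge) auto
qed

text \<open>An edge cannot be a whole component of a connected graph of order at least 3. Some edge
  therefore leaves \<open>{a, b}\<close>, and the end it leaves from has two neighbours.\<close>

lemma ex_degree_ge_2:
  assumes "card (verts G) \<ge> 3"
  obtains u x y where "u \<in> verts G" "x \<in> verts G" "y \<in> verts G" "x \<noteq> y" "u \<rightarrow> x" "u \<rightarrow> y"
proof -
  obtain a where a: "a \<in> verts G" using assms by fastforce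
  then obtain b where b: "b \<in> verts G" "a \<rightarrow> b" by (rule ex_neighbour)
  have "card {a, b} < 3" by (simp add: card_insert_if)
  then have "{a, b} \<subset> verts G" using a b assms by auto
  then obtain x z where xz: "x \<in> {a, b}" "z \<in> verts G - {a, b}" "x \<rightarrow> z"
    by (rule cut_edge) auto
  consider "x = a" | "x = b" using xz(1) by blast
  then show thesis
  proof cases
    case 1
    then show thesis using that[of a b z] a b xz by blast
  next
    case 2
    then show thesis using that[of b a z] a b xz adj_sym by blast
  qed
qed

section \<open>The minima as bounds that are attained\<close>

lemma total_domination_number_le:
  "total_dominating_set G T \<Longrightarrow> total_domination_number G \<le> card T"
  unfolding total_domination_number_def by (rule Least_le) blast

lemma domination_number_le: "dominating_set G S \<Longrightarrow> domination_number G \<le> card S"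
  unfolding domination_number_def by (rule Least_le) blast

lemma total_roman_domination_number_le:
  "trd_function G f \<Longrightarrow> total_roman_domination_number G \<le> trd_weight G f"
  unfolding total_roman_domination_number_def by (rule Least_le) blast

lemma total_dominating_set_verts: "total_dominating_set G (verts G)"
  unfolding total_dominating_set_def using ex_neighbour by blast

lemma ex_min_total_dominating_set:
  obtains T where "total_dominating_set G T" "card T = total_domination_number G"
proof -
  have "\<exists>k T. total_dominating_set G T \<and> card T = k" using total_dominating_set_verts by blast
  then have "\<exists>T. total_dominating_set G T \<and> card T = total_domination_number G"
    unfolding total_domination_number_def by (rule LeastI_ex)
  then show thesis using that by blast
qed

lemma ex_min_dominating_set:
  obtains S where "dominating_set G S" "card S = domination_number G"
proof -
  have "dominating_set G (verts G)" by (auto simp: dominating_set_def)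
  then have "\<exists>k S. dominating_set G S \<and> card S = k" by blast
  then have "\<exists>S. dominating_set G S \<and> card S = domination_number G"
    unfolding domination_number_def by (rule LeastI_ex)
  then show thesis using that by blast
qed

lemma no_total_dominating_pair:
  assumes "total_domination_number G \<ge> 3"
  shows "\<not> total_dominating_set G {x, y}"
proof
  assume "total_dominating_set G {x, y}"
  then have "total_domination_number G \<le> card {x, y}" by (rule total_domination_number_le)
  then show False using assms by (cases "x = y") auto
qed

section \<open>TRD-functions, their supports and weights\<close>

lemma trd_function_iff:
  "trd_function G f \<longleftrightarrow>
     (\<forall>v \<in> verts G. f v \<in> {0, 1, 2}) \<and>
     (\<forall>v \<in> verts G. f v = 0 \<longrightarrow> (\<exists>u \<in> verts G. v \<rightarrow> u \<and> f u = 2)) \<and>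
     (\<forall>v \<in> verts G. f v > 0 \<longrightarrow> (\<exists>u \<in> verts G. v \<rightarrow> u \<and> f u > 0))"
proof -
  have "no_isolated_verts (G \<restriction> {w \<in> verts G. f w > 0}) \<longleftrightarrow>
     (\<forall>v \<in> verts G. f v > 0 \<longrightarrow> (\<exists>u \<in> verts G. v \<rightarrow> u \<and> f u > 0))"
    (is "no_isolated_verts (G \<restriction> ?W) \<longleftrightarrow> _")
  proof -
    \<comment> \<open>Adjacency in the induced subgraph is adjacency in \<open>G\<close> between two
      vertices of positive value, so the condition on the subgraph becomes one on \<open>G\<close>
      alone.\<close>
    have "v \<rightarrow>\<^bsub>G \<restriction> ?W\<^esub> u \<longleftrightarrow> v \<rightarrow> u \<and> v \<in> ?W \<and> u \<in> ?W" for u v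
      unfolding arcs_ends_conv by auto
    then show ?thesis unfolding no_isolated_verts_def by auto
  qed
  then show ?thesis unfolding trd_function_def by blast
qed

lemma total_dominating_support:
  assumes "trd_function G f"
  shows "total_dominating_set G {v \<in> verts G. f v > 0}"
  unfolding total_dominating_set_def
proof (intro conjI ballI)
  fix v assume "v \<in> verts G"
  then show "\<exists>u\<in>{v \<in> verts G. f v > 0}. v \<rightarrow> u"
    using assms unfolding trd_function_iff by (cases "f v = 0") fastforce+
qed auto

lemma trd_weight_eq:
  assumes "trd_function G f"
  shows "trd_weight G f = card {v \<in> verts G. f v = 1} + 2 * card {v \<in> verts G. f v = 2}"
proof -
  have "trd_weight G f = (\<Sum>v\<in>verts G. (if f v = 1 then 1 else 0) + 2 * (if f v = 2 then 1 else 0))"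
    unfolding trd_weight_def using assms by (intro sum.cong) (auto simp: trd_function_iff)
  also have "\<dots> = (\<Sum>v\<in>verts G. if f v = 1 then 1 else 0) + 2 * (\<Sum>v\<in>verts G. if f v = 2 then 1 else 0)"
    by (simp add: sum.distrib sum_distrib_left)
  finally show ?thesis by (simp add: sum.If_cases Int_def)
qed

lemma support_eq:
  assumes "trd_function G f"
  shows "{v \<in> verts G. f v > 0} = {v \<in> verts G. f v = 1} \<union> {v \<in> verts G. f v = 2}"
  using assms by (auto simp: trd_function_iff)

lemma card_support:
  assumes "trd_function G f"
  shows "card {v \<in> verts G. f v > 0} = card {v \<in> verts G. f v = 1} + card {v \<in> verts G. f v = 2}"
  unfolding support_eq[OF assms] by (rule card_Un_disjoint) auto

lemma total_roman_domination_number_le_sum: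
  assumes T: "total_dominating_set G T" and S: "dominating_set G S" and "S \<subseteq> T"
  shows "total_roman_domination_number G \<le> card T + card S"
proof -
  define f :: "'a \<Rightarrow> nat" where "f v = (if v \<in> S then 2 else if v \<in> T then 1 else 0)" for v
  have TV: "T \<subseteq> verts G" using T by (simp add: total_dominating_set_def)
  have pos: "f v > 0 \<longleftrightarrow> v \<in> T" for v using \<open>S \<subseteq> T\<close> by (auto simp: f_def)
  have f: "trd_function G f"
    unfolding trd_function_iff
  proof (intro conjI ballI impI)
    fix v assume v: "v \<in> verts G"
    show "f v \<in> {0, 1, 2}" by (simp add: f_def)
    show "\<exists>u\<in>verts G. v \<rightarrow> u \<and> f u = 2" if "f v = 0"
    proof -
      have "v \<notin> S" using that by (auto simp: f_def)
      then obtain u where "u \<in> S" "v \<rightarrow> u" using S v by (auto simp: dominating_set_def)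
      then show ?thesis using TV \<open>S \<subseteq> T\<close> by (auto simp: f_def)
    qed
    \<comment> \<open>The support of \<open>f\<close> is \<open>T\<close>, so every vertex, whatever
      its value, has a neighbour of positive value.\<close>
    show "\<exists>u\<in>verts G. v \<rightarrow> u \<and> f u > 0"
      using T v TV unfolding pos total_dominating_set_def by blast
  qed
  have fin: "finite T" using TV finite_verts by (rule finite_subset)
  have "{v \<in> verts G. f v = 1} = T - S" "{v \<in> verts G. f v = 2} = S"
    using TV \<open>S \<subseteq> T\<close> by (auto simp: f_def split: if_splits)
  then have "trd_weight G f = card (T - S) + 2 * card S" using trd_weight_eq[OF f] by simp
  also have "\<dots> = card T + card S"
    using \<open>S \<subseteq> T\<close> fin card_mono[of T S] by (simp add: card_Diff_subset finite_subset)
  finally show ?thesis using total_roman_domination_number_le[OF f] by simp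
qed

text \<open>A total dominating set is dominating, so it can play both roles in the preceding bound.
  Hence the value 5 forces \<open>\<gamma>\<^sub>t\<close> to be at least 3.\<close>

lemma total_roman_domination_number_le_double:
  "total_roman_domination_number G \<le> 2 * total_domination_number G"
proof -
  obtain T where T: "total_dominating_set G T" "card T = total_domination_number G"
    by (rule ex_min_total_dominating_set)
  then have "dominating_set G T" by (auto simp: total_dominating_set_def dominating_set_def)
  then show ?thesis using total_roman_domination_number_le_sum[OF T(1), of T] T(2) by simp
qed

lemma ex_min_trd_function:
  obtains f where "trd_function G f" "trd_weight G f = total_roman_domination_number G"
proof -
  have "trd_function G (\<lambda>_. 1)" unfolding trd_function_iff using ex_neighbour by auto
  then have "\<exists>k f. trd_function G f \<and> trd_weight G f = k" by blast
  then have "\<exists>f. trd_function G f \<and> trd_weight G f = total_roman_domination_number G"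
    unfolding total_roman_domination_number_def by (rule LeastI_ex)
  then show thesis using that by blast
qed

section \<open>Non-neighbours of a vertex and the bound from below on their number\<close>

definition non_neighbours :: "'a \<Rightarrow> 'a set" where
  "non_neighbours u = {v \<in> verts G. v \<noteq> u \<and> \<not> v \<rightarrow> u}"

lemma finite_non_neighbours: "finite (non_neighbours u)"
  by (simp add: non_neighbours_def)

lemma card_non_neighbours_ge_2:
  assumes gt: "total_domination_number G \<ge> 3" and u: "u \<in> verts G"
  shows "card (non_neighbours u) \<ge> 2"
proof (rule ccontr)
  assume less: "\<not> ?thesis"
  obtain w where w: "w \<in> verts G" "w \<rightarrow> u" "\<forall>b \<in> non_neighbours u. b \<rightarrow> w"
  proof (cases "non_neighbours u = {}")
    case True
    obtain w where "w \<in> verts G" "u \<rightarrow> w" using u by (rule ex_neighbour)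
    then show thesis using that True adj_sym by blast
  next
    case False
    then have "card (non_neighbours u) = 1"
      using less finite_non_neighbours[of u] card_gt_0_iff[of "non_neighbours u"] by linarith
    then obtain b where b: "non_neighbours u = {b}" by (auto simp: card_1_singleton_iff)
    then have bu: "b \<in> verts G" "\<not> b \<rightarrow> u" by (auto simp: non_neighbours_def)
    obtain w where w: "w \<in> verts G" "b \<rightarrow> w" "w \<noteq> b" using bu(1) by (rule ex_neighbour)
    \<comment> \<open>The vertex \<open>w\<close> is not \<open>u\<close>, since \<open>b\<close> is
      not adjacent to \<open>u\<close>, and not \<open>b\<close>, the only non-neighbour of
      \<open>u\<close>. So it is a common neighbour of \<open>b\<close> and
      \<open>u\<close>.\<close>
    then have "w \<notin> non_neighbours u" "w \<noteq> u" using b bu by auto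
    then have "w \<rightarrow> u" using w by (auto simp: non_neighbours_def)
    moreover have "\<forall>x \<in> non_neighbours u. x \<rightarrow> w" using b w(2) by simp
    ultimately show thesis using that w(1) by simp
  qed
  have "total_dominating_set G {u, w}"
    unfolding total_dominating_set_def
  proof (intro conjI ballI)
    fix v assume v: "v \<in> verts G"
    consider "v = u" | "v \<rightarrow> u" | "v \<in> non_neighbours u" using v by (auto simp: non_neighbours_def)
    then show "\<exists>x\<in>{u, w}. v \<rightarrow> x" using w adj_sym by cases auto
  qed (use u w in auto)
  then show False using no_total_dominating_pair[OF gt] by blast
qed

text \<open>A vertex that dominates alone has no non-neighbours. The bound later shows that a
  dominating set of size 2 is minimum.\<close>

lemma domination_number_ge_2:
  assumes gt: "total_domination_number G \<ge> 3"
  shows "domination_number G \<ge> 2"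
proof (rule ccontr)
  assume less: "\<not> ?thesis"
  obtain S where S: "dominating_set G S" "card S = domination_number G"
    by (rule ex_min_dominating_set)
  have fin: "finite S" using S finite_subset[OF _ finite_verts] by (auto simp: dominating_set_def)
  obtain z where "z \<in> verts G" using order_ge_2 by fastforce
  then have "S \<noteq> {}" using S by (auto simp: dominating_set_def)
  then have "card S = 1"
    using less S fin card_gt_0_iff[of S] by linarith
  then obtain u where u: "S = {u}" by (auto simp: card_1_singleton_iff)
  then have "u \<in> verts G" "non_neighbours u = {}"
    using S by (auto simp: dominating_set_def non_neighbours_def)
  then show False using card_non_neighbours_ge_2[OF gt] by fastforce
qed

section \<open>At most one vertex of value 2, and the lower bound 5 on the weight\<close>

lemma all_ones_if_no_twos:
  assumes f: "trd_function G f" and "card {v \<in> verts G. f v = 2} = 0"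
  shows "{v \<in> verts G. f v = 1} = verts G"
proof -
  have "{v \<in> verts G. f v = 2} = {}" using assms(2) by simp
  then show ?thesis using f unfolding trd_function_iff by blast
qed

text \<open>A non-neighbour of \<open>u\<close> cannot have value 0, as \<open>u\<close> is the only
  vertex of value 2; so it has value 1. The vertex \<open>a\<close> is the neighbour of positive
  value that \<open>u\<close> must have. It also has value 1 but is not a non-neighbour, which saves
  one in the count.\<close>

lemma single_two:
  assumes f: "trd_function G f" and "card {v \<in> verts G. f v = 2} = 1"
  obtains u a where "{v \<in> verts G. f v = 2} = {u}" "u \<in> verts G" "a \<in> {v \<in> verts G. f v = 1}"
    "a \<rightarrow> u" "non_neighbours u \<subseteq> {v \<in> verts G. f v = 1} - {a}"
proof -
  obtain u where u: "{v \<in> verts G. f v = 2} = {u}"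
    using assms(2) by (auto simp: card_1_singleton_iff)
  then have uV: "u \<in> verts G" "f u = 2" by auto
  then obtain a where a: "a \<in> verts G" "u \<rightarrow> a" "f a > 0"
    using f unfolding trd_function_iff by fastforce
  have "a \<noteq> u" using a(2) adj_not_same by blast
  then have "f a \<noteq> 2" using a(1) u by auto
  then have a1: "f a = 1" using f a unfolding trd_function_iff by fastforce
  have "v \<in> {v \<in> verts G. f v = 1} - {a}" if v: "v \<in> non_neighbours u" for v
  proof -
    have v': "v \<in> verts G" "v \<noteq> u" "\<not> v \<rightarrow> u" using v by (auto simp: non_neighbours_def)
    have "f v \<noteq> 2" using u v' by auto
    moreover have "f v \<noteq> 0"
    proof
      assume "f v = 0"
      then obtain x where "x \<in> verts G" "v \<rightarrow> x" "f x = 2"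
        using f v' unfolding trd_function_iff by blast
      then have "x = u" using u by blast
      then show False using \<open>v \<rightarrow> x\<close> v'(3) by blast
    qed
    ultimately have "f v = 1" using f v' unfolding trd_function_iff by fastforce
    then show ?thesis using v' adj_sym[OF a(2)] by auto
  qed
  then show thesis using that[OF u uV(1), of a] a a1 adj_sym by blast
qed

lemma non_neighbours_subset:
  assumes "u \<rightarrow> x" "u \<rightarrow> y"
  shows "non_neighbours u \<subseteq> verts G - {u, x, y}"
  using assms adj_sym by (auto simp: non_neighbours_def)

lemma trd_weight_ge_5:
  assumes gt: "total_domination_number G \<ge> 3" and f: "trd_function G f"
  shows "trd_weight G f \<ge> 5"
proof (rule ccontr)
  assume less: "\<not> ?thesis"
  let ?A = "{v \<in> verts G. f v = 1}" and ?B = "{v \<in> verts G. f v = 2}"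
  have sum: "card ?A + 2 * card ?B \<le> 4" using less trd_weight_eq[OF f] by simp
  have ge: "card ?A + card ?B \<ge> 3"
    using total_domination_number_le[OF total_dominating_support[OF f]] gt card_support[OF f]
    by simp
  \<comment> \<open>Subtracting the two inequalities leaves at most one vertex of value 2; if there
    is one, exactly two vertices have value 1.\<close>
  consider "card ?B = 0" | "card ?B = 1" "card ?A = 2" using sum ge by linarith
  then show False
  proof cases
    case 1
    then have "?A = verts G" using f all_ones_if_no_twos by blast
    then have "card ?A = card (verts G)" by (rule arg_cong)
    then have n: "3 \<le> card (verts G)" "card (verts G) \<le> 4" using 1 sum ge by linarith+
    \<comment> \<open>The order is 3 or 4, so a vertex with two neighbours has at most one
      non-neighbour.\<close>
    obtain u x y where u: "u \<in> verts G" "x \<in> verts G" "y \<in> verts G" "x \<noteq> y" "u \<rightarrow> x" "u \<rightarrow> y"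
      using n(1) by (rule ex_degree_ge_2)
    have "u \<noteq> x" "u \<noteq> y" using u adj_not_same by blast+
    then have "card (verts G - {u, x, y}) = card (verts G) - 3" using u by (simp add: card_Diff_subset)
    then have "card (non_neighbours u) \<le> 1"
      using n card_mono[OF _ non_neighbours_subset[OF u(5,6)]] by simp
    then show False using card_non_neighbours_ge_2[OF gt u(1)] by simp
  next
    case 2
    obtain u a where u: "u \<in> verts G" "a \<in> ?A" "non_neighbours u \<subseteq> ?A - {a}"
      using f 2(1) by (rule single_two)
    have "card (non_neighbours u) \<le> card (?A - {a})" using u(3) by (intro card_mono) auto
    also have "\<dots> = 1" using u(2) 2(2) by (subst card_Diff_singleton) auto
    finally show False using card_non_neighbours_ge_2[OF gt u(1)] by simp
  qed
qed

section \<open>Weight 5: a dominating pair inside a total dominating triple\<close>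

definition good_pair :: "'a set \<Rightarrow> 'a set \<Rightarrow> bool" where
  "good_pair S T \<longleftrightarrow> dominating_set G S \<and> total_dominating_set G T \<and> card S = 2 \<and> card T = 3 \<and> S \<subseteq> T"

text \<open>The set \<open>{u, b}\<close> dominates, since \<open>b\<close> covers \<open>c\<close>.
  An edge from \<open>b\<close> to some \<open>w\<close> outside \<open>{b, c}\<close> ends at a
  neighbour of \<open>u\<close>, and adding \<open>w\<close> gives both \<open>u\<close> and
  \<open>b\<close> a neighbour in the set.\<close>

lemma good_pair_adjacent_non_neighbours:
  assumes u: "u \<in> verts G" and A: "non_neighbours u = {b, c}" and bc: "b \<rightarrow> c"
  shows "\<exists>S T. good_pair S T"
proof -
  \<comment> \<open>Here \<open>b\<close> and \<open>c\<close> are arbitrary, because the edge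
    leaving the pair may start at either of them.\<close>
  have *: "\<exists>S T. good_pair S T"
    if A: "non_neighbours u = {b, c}" and bc: "b \<rightarrow> c"
      and w: "w \<in> verts G - {b, c}" "b \<rightarrow> w" for b c w
  proof -
    have b: "b \<in> verts G" "b \<noteq> u" "\<not> b \<rightarrow> u" using A by (auto simp: non_neighbours_def)
    have wu: "w \<noteq> u" using w b by auto
    have "w \<notin> non_neighbours u" using w A by simp
    then have wu': "w \<rightarrow> u" using w wu by (auto simp: non_neighbours_def)
    have dom: "v = u \<or> v = b \<or> v = c \<or> v \<rightarrow> u" if "v \<in> verts G" for v
      using that A by (auto simp: non_neighbours_def)
    have "dominating_set G {u, b}" unfolding dominating_set_def
      using u b dom bc adj_sym by blast
    moreover have "total_dominating_set G {u, b, w}" unfolding total_dominating_set_def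
      using u b dom bc wu' w adj_sym by blast
    moreover have "card {u, b} = 2" "card {u, b, w} = 3" using b w wu by auto
    ultimately have "good_pair {u, b} {u, b, w}" unfolding good_pair_def by blast
    then show ?thesis by blast
  qed
  have "u \<notin> {b, c}" "{b, c} \<subseteq> verts G" unfolding A[symmetric] by (auto simp: non_neighbours_def)
  then have "{b, c} \<subset> verts G" using u by blast
  then obtain x w where xw: "x \<in> {b, c}" "w \<in> verts G - {b, c}" "x \<rightarrow> w" by (rule cut_edge) auto
  consider "x = b" | "x = c" using xw(1) by blast
  then show ?thesis
  proof cases
    case 1
    then show ?thesis using *[OF A bc] xw by blast
  next
    case 2
    then show ?thesis using *[of c b w] A adj_sym[OF bc] xw by (auto simp: insert_commute)
  qed
qed

text \<open>If \<open>b\<close> and \<open>c\<close> are not adjacent, their neighbours lie in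
  \<open>{x, y}\<close>, since neither is adjacent to \<open>u\<close>. Then \<open>{x, y}\<close>
  dominates, and adding \<open>u\<close> makes it total.\<close>

lemma good_pair_five_vertices:
  assumes gt: "total_domination_number G \<ge> 3" and n: "card (verts G) = 5"
  shows "\<exists>S T. good_pair S T"
proof -
  obtain u x y where u: "u \<in> verts G" "x \<in> verts G" "y \<in> verts G" "x \<noteq> y" "u \<rightarrow> x" "u \<rightarrow> y"
    using ex_degree_ge_2 n by auto
  have ne: "u \<noteq> x" "u \<noteq> y" using u adj_not_same by blast+
  have c2: "card (verts G - {u, x, y}) = 2" using u ne n by (simp add: card_Diff_subset)
  \<comment> \<open>Two non-neighbours at least and two remaining vertices at most: the inclusion is
    an equality.\<close>
  have N: "non_neighbours u = verts G - {u, x, y}"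
    using card_non_neighbours_ge_2[OF gt u(1)] c2
    by (intro card_seteq non_neighbours_subset u) auto
  then obtain b c where bc: "non_neighbours u = {b, c}" "b \<noteq> c" using c2 by (metis card_2_iff)
  show ?thesis
  proof (cases "b \<rightarrow> c")
    case True
    then show ?thesis using good_pair_adjacent_non_neighbours u bc by blast
  next
    case False
    have "v \<rightarrow> x \<or> v \<rightarrow> y" if v: "v \<in> non_neighbours u" for v
    proof -
      have v': "v \<in> verts G" "\<not> v \<rightarrow> u" using v by (auto simp: non_neighbours_def)
      obtain w where w: "w \<in> verts G" "v \<rightarrow> w" "w \<noteq> v" using v'(1) by (rule ex_neighbour)
      have "w \<notin> {b, c}" using w v False adj_sym unfolding bc by blast
      then have "w \<in> {u, x, y}" using w N bc by blast
      then show ?thesis using w v' by blast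
    qed
    then have dom: "v \<rightarrow> x \<or> v \<rightarrow> y" if "v \<in> verts G - {x, y}" for v
      using that u unfolding N by blast
    have "dominating_set G {x, y}" unfolding dominating_set_def using u dom by blast
    moreover have "total_dominating_set G {u, x, y}" unfolding total_dominating_set_def
      using u dom adj_sym by blast
    moreover have "card {x, y} = 2" "card {u, x, y} = 3" using u ne by auto
    ultimately have "good_pair {x, y} {u, x, y}" unfolding good_pair_def by blast
    then show ?thesis by blast
  qed
qed

text \<open>The support is \<open>{u, a, b, c}\<close>. If \<open>b\<close> and \<open>c\<close> are
  not adjacent, each can find its neighbour in the support only at \<open>a\<close>; then
  \<open>{u, a}\<close> is a total dominating set, which is impossible. So only the adjacent case
  occurs.\<close>

lemma good_pair_single_two:
  assumes gt: "total_domination_number G \<ge> 3" and f: "trd_function G f"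
    and B: "card {v \<in> verts G. f v = 2} = 1" and A: "card {v \<in> verts G. f v = 1} = 3"
  shows "\<exists>S T. good_pair S T"
proof -
  let ?A = "{v \<in> verts G. f v = 1}"
  obtain u a where u: "{v \<in> verts G. f v = 2} = {u}" "u \<in> verts G" "a \<in> ?A" "a \<rightarrow> u"
    "non_neighbours u \<subseteq> ?A - {a}"
    using f B by (rule single_two)
  have c2: "card (?A - {a}) = 2" using u(3) A by (subst card_Diff_singleton) auto
  have N: "non_neighbours u = ?A - {a}"
    using card_non_neighbours_ge_2[OF gt u(2)] c2 by (intro card_seteq u) auto
  then obtain b c where bc: "non_neighbours u = {b, c}" "b \<noteq> c" using c2 by (metis card_2_iff)
  show ?thesis
  proof (cases "b \<rightarrow> c")
    case True
    then show ?thesis using good_pair_adjacent_non_neighbours u bc by blast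
  next
    case False
    have va: "v \<rightarrow> a" if v: "v \<in> non_neighbours u" for v
    proof -
      have v': "v \<in> verts G" "\<not> v \<rightarrow> u" using v by (auto simp: non_neighbours_def)
      obtain w where w: "w \<in> {v \<in> verts G. f v > 0}" "v \<rightarrow> w"
        using total_dominating_support[OF f] v' unfolding total_dominating_set_def by blast
      have "w \<noteq> v" using w adj_not_same by blast
      then have "w \<notin> {b, c}" using w v False adj_sym unfolding bc by blast
      moreover have "w \<in> ?A \<union> {u}" using w(1) unfolding support_eq[OF f] u(1) .
      ultimately have "w = a" using w v' N bc by blast
      then show ?thesis using w by simp
    qed
    have "v = u \<or> v \<rightarrow> u \<or> v \<rightarrow> a" if "v \<in> verts G" for v
      using that va by (auto simp: non_neighbours_def)
    then have "total_dominating_set G {u, a}" unfolding total_dominating_set_def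
      using u adj_sym by blast
    then show ?thesis using no_total_dominating_pair[OF gt] by blast
  qed
qed

text \<open>The only vertex of value 1 has a neighbour in the support, and this must have value 2.
  So the two vertices of value 2 dominate not only the vertices of value 0 but all others.\<close>

lemma good_pair_two_twos:
  assumes f: "trd_function G f"
    and B: "card {v \<in> verts G. f v = 2} = 2" and A: "card {v \<in> verts G. f v = 1} = 1"
  shows "\<exists>S T. good_pair S T"
proof -
  let ?A = "{v \<in> verts G. f v = 1}" and ?B = "{v \<in> verts G. f v = 2}"
  have tds: "total_dominating_set G (?A \<union> ?B)"
    using total_dominating_support[OF f] unfolding support_eq[OF f] .
  obtain a where a: "?A = {a}" using A by (auto simp: card_1_singleton_iff)
  have "\<exists>x \<in> ?B. v \<rightarrow> x" if v: "v \<in> verts G - ?B" for v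
  proof (cases "f v = 0")
    case True
    then show ?thesis using f v unfolding trd_function_iff by blast
  next
    case False
    then have "v \<in> ?A" using f v unfolding trd_function_iff by fastforce
    then have "v = a" using a by blast
    moreover obtain x where "x \<in> ?A \<union> ?B" "v \<rightarrow> x"
      using tds v unfolding total_dominating_set_def by blast
    moreover have "x \<noteq> v" using \<open>v \<rightarrow> x\<close> adj_not_same by blast
    ultimately show ?thesis using a by blast
  qed
  then have "dominating_set G ?B" unfolding dominating_set_def by blast
  moreover have "card (?A \<union> ?B) = 3"
    using card_support[OF f] A B unfolding support_eq[OF f] by simp
  ultimately have "good_pair ?B (?A \<union> ?B)" using tds B unfolding good_pair_def by blast
  then show ?thesis by blast
qed

lemma weight_5_cases:
  fixes a b :: nat
  assumes "a + 2 * b = 5"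
  shows "b = 0 \<and> a = 5 \<or> b = 1 \<and> a = 3 \<or> b = 2 \<and> a = 1"
  using assms by presburger

lemma total_roman_domination_number_eq_5_imp_good_pair:
  assumes "total_roman_domination_number G = 5"
  shows "total_domination_number G \<ge> 3" "\<exists>S T. good_pair S T"
proof -
  show gt: "total_domination_number G \<ge> 3"
    using total_roman_domination_number_le_double assms by linarith
  obtain f where f: "trd_function G f" "trd_weight G f = 5"
    using ex_min_trd_function assms by metis
  let ?A = "{v \<in> verts G. f v = 1}" and ?B = "{v \<in> verts G. f v = 2}"
  have "card ?A + 2 * card ?B = 5" using f trd_weight_eq by simp
  then consider "card ?B = 0" "card ?A = 5" | "card ?B = 1" "card ?A = 3" | "card ?B = 2" "card ?A = 1"
    by (metis (no_types, lifting) weight_5_cases)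
  then show "\<exists>S T. good_pair S T"
  proof cases
    case 1
    then show ?thesis using all_ones_if_no_twos[OF f(1)] good_pair_five_vertices[OF gt] by simp
  next
    case 2
    then show ?thesis using good_pair_single_two[OF gt f(1)] by blast
  next
    case 3
    then show ?thesis using good_pair_two_twos[OF f(1)] by blast
  qed
qed

end

theorem theorem5p2:
  fixes G :: "('a, 'b) pre_digraph"
  assumes "graph G" and "connected G" and "card (verts G) \<ge> 2"
  shows "total_roman_domination_number G = 5 \<longleftrightarrow>
    total_domination_number G = 3 \<and>
    (\<exists>S T. min_dominating_set G S \<and> min_total_dominating_set G T \<and> S \<subset> T)"
proof -
  interpret connected_graph G
    using assms by (simp add: connected_graph_def connected_graph_axioms_def)
  show ?thesis
  proof
    assume R: "total_roman_domination_number G = 5"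
    note gt = total_roman_domination_number_eq_5_imp_good_pair(1)[OF R]
    obtain S T where ST: "dominating_set G S" "total_dominating_set G T" "card S = 2" "card T = 3" "S \<subseteq> T"
      using total_roman_domination_number_eq_5_imp_good_pair(2)[OF R] unfolding good_pair_def by blast
    have "total_domination_number G = 3"
      using gt total_domination_number_le[OF ST(2)] ST by simp
    moreover have "domination_number G = 2"
      using domination_number_ge_2[OF gt] domination_number_le[OF ST(1)] ST by simp
    \<comment> \<open>The inclusion is proper because the sizes are 2 and 3.\<close>
    moreover have "S \<subset> T" using ST by auto
    ultimately show "total_domination_number G = 3 \<and>
      (\<exists>S T. min_dominating_set G S \<and> min_total_dominating_set G T \<and> S \<subset> T)"
      using ST unfolding min_dominating_set_def min_total_dominating_set_def by metis
  next
    assume R: "total_domination_number G = 3 \<and>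
      (\<exists>S T. min_dominating_set G S \<and> min_total_dominating_set G T \<and> S \<subset> T)"
    then obtain S T where ST: "dominating_set G S" "total_dominating_set G T" "card T = 3" "S \<subset> T"
      unfolding min_dominating_set_def min_total_dominating_set_def by metis
    \<comment> \<open>Proper inclusion in a triple leaves at most two vertices for \<open>S\<close>,
      so the weight bound is 3 + 2.\<close>
    then have "card S < 3" using psubset_card_mono[of T S] card_ge_0_finite[of T] by simp
    then have "total_roman_domination_number G \<le> 5"
      using total_roman_domination_number_le_sum[OF ST(2,1) psubset_imp_subset[OF ST(4)]] ST(3) by simp
    moreover obtain f where "trd_function G f" "trd_weight G f = total_roman_domination_number G"
      by (rule ex_min_trd_function)
    then have "total_roman_domination_number G \<ge> 5" using trd_weight_ge_5[of f] R by simp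
    ultimately show "total_roman_domination_number G = 5" by simp
  qed
qed

end
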